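(* Let $f,g,h$ be monotone functions on binary relations over a set $X$, and let $m\ge 1$ be an integer. Suppose $f$ is $g$-compatible and $g^m,h$-compatible. Let $f'=\bigcup_{0\le i\le m}f^i$. Then $f$ is $(g\cap h)$-sound via $f'^\omega$; that is, $f'^\omega$ is extensive and for every relation $\mathcal R$ on $X$, $\mathcal R\subseteq (g\cap h)(f(\mathcal R))$ implies $f'^\omega(\mathcal R)\subseteq (g\cap h)(f'^\omega(\mathcal R))$.
   Context: Fix a set $X$. A function on relations is a map from the set of binary relations on $X$ to itself. For such functions, $(f\circ g)(\mathcal R)=f(g(\mathcal R))$, $(f\cap g)(\mathcal R)=f(\mathcal R)\cap g(\mathcal R)$, $(f\cup g)(\mathcal R)=f(\mathcal R)\cup g(\mathcal R)$ (and similarly for indexed unions), and $f\subseteq g$ means $f(\mathcal R)\subseteq g(\mathcal R)$ for all $\mathcal R$. $f^0=\mathrm{id}$, $f^{n+1}=f\circ f^n$, $f^\omega(\mathcal R)=\bigcup_{n\in\mathbb N}f^n(\mathcal R)$. $f$ is monotone if $\mathcal R\subseteq\mathcal S$ implies $f(\mathcal R)\subseteq f(\mathcal S)$; $f$ is extensive if $\mathrm{id}\subseteq f$. $f$ is $g$-compatible if $f\circ g\subseteq g\circ f$. $f$ is $g,h$-compatible if $f\circ(g\cap h)\subseteq h\circ f$. $f$ is $g$-sound via $f'$ if $f'$ is extensive and for every relation $\mathcal R$, $\mathcal R\subseteq g(f(\mathcal R))$ implies $f'(\mathcal R)\subseteq g(f'(\mathcal R))$. *)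

theory Defs
  imports Main
begin

text \<open>The underlying set is the universe of the type \<open>'a\<close>. Functions on relations carry the pointwise
  lattice structure of the function space, so \<open>\<le>\<close>, \<open>inf\<close>, \<open>sup\<close> and \<open>SUP\<close> on them are pointwise
  inclusion, intersection and (indexed) union; \<open>f ^^ n\<close> is the n-fold iterate.\<close>

type_synonym 'a relfun = "'a rel \<Rightarrow> 'a rel"

definition omega :: "'a relfun \<Rightarrow> 'a relfun" where
  "omega f R = (\<Union>n. (f ^^ n) R)"

definition extensive :: "'a relfun \<Rightarrow> bool" where
  "extensive f \<longleftrightarrow> id \<le> f"

definition compatible :: "'a relfun \<Rightarrow> 'a relfun \<Rightarrow> bool" where
  "compatible f g \<longleftrightarrow> f \<circ> g \<le> g \<circ> f"

definition compatible2 :: "'a relfun \<Rightarrow> 'a relfun \<Rightarrow> 'a relfun \<Rightarrow> bool" where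
  "compatible2 f g h \<longleftrightarrow> f \<circ> inf g h \<le> h \<circ> f"

definition sound_via :: "'a relfun \<Rightarrow> 'a relfun \<Rightarrow> 'a relfun \<Rightarrow> bool" where
  "sound_via f g f' \<longleftrightarrow> extensive f' \<and> (\<forall>R. R \<subseteq> g (f R) \<longrightarrow> f' R \<subseteq> g (f' R))"

end

theory Submission
  imports Defs
begin

text \<open>Put \<open>R\<^sub>n = f'\<^sup>n(R)\<close>. Compatibility propagates \<open>R \<subseteq> g(f(R))\<close> to \<open>R\<^sub>n \<subseteq> g(f(R\<^sub>n))\<close>, and hence
  to \<open>R\<^sub>n \<subseteq> g\<^sup>m(f\<^sup>m(R\<^sub>n)) \<subseteq> g\<^sup>m(R\<^sub>n\<^sub>+\<^sub>1)\<close>. So the \<open>g\<^sup>m\<close>-half of the hypothesis of \<open>g\<^sup>m,h\<close>-compatibility is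
  available at every stage, and \<open>R\<^sub>n \<subseteq> h(R\<^sub>k)\<close> follows by induction on \<open>n\<close> as long as the index \<open>k\<close>
  grows by \<open>m\<close> at each step. Working with finite stages \<open>R\<^sub>k\<close> rather than their union is essential,
  as \<open>f\<close> need not commute with unions.\<close>

lemma funpow_compatible:
  assumes "mono f" and "compatible f g"
  shows "(f ^^ i) (g S) \<subseteq> g ((f ^^ i) S)"
proof (induction i)
  case (Suc i)
  have "f ((f ^^ i) (g S)) \<subseteq> f (g ((f ^^ i) S))"
    using assms(1) Suc by (rule monoD)
  also have "\<dots> \<subseteq> g (f ((f ^^ i) S))"
    using assms(2) by (auto simp: compatible_def le_fun_def)
  finally show ?case by simp
qed simp

text \<open>Applying \<open>f ^^ i\<close> to the hypothesis and moving it past \<open>g\<close>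
  gives \<open>(f ^^ i) S \<subseteq> g ((f ^^ Suc i) S)\<close>; the outer \<open>g ^^ i\<close>
  then gains one more layer.\<close>

lemma subset_funpow_funpow:
  assumes "mono f" and "mono g" and "compatible f g" and "S \<subseteq> g (f S)"
  shows "S \<subseteq> (g ^^ i) ((f ^^ i) S)"
proof (induction i)
  case (Suc i)
  have "(f ^^ i) S \<subseteq> (f ^^ i) (g (f S))"
    using funpow_mono[OF assms(1,4)] .
  also have "\<dots> \<subseteq> g ((f ^^ i) (f S))"
    using assms(1,3) by (rule funpow_compatible)
  finally have "(g ^^ i) ((f ^^ i) S) \<subseteq> (g ^^ i) (g ((f ^^ i) (f S)))"
    by (rule funpow_mono[OF assms(2)])
  with Suc show ?case by (simp add: funpow_swap1)
qed simp

theorem theorem15: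
  fixes f g h :: "'a rel \<Rightarrow> 'a rel" and m :: nat
  assumes "mono f" and "mono g" and "mono h"
    and "m \<ge> 1"
    and "compatible f g"
    and "compatible2 f (g ^^ m) h"
  shows "sound_via f (inf g h) (omega (SUP i\<in>{0..m}. f ^^ i))"
proof -
  define F where "F = (SUP i\<in>{0..m}. f ^^ i)"
  have F: "F S = (\<Union>i\<in>{0..m}. (f ^^ i) S)" for S
    by (simp add: F_def image_image)
  have funpow_F: "(f ^^ i) S \<subseteq> F S" if "i \<le> m" for i S
    using that by (auto simp: F)
  have f_F: "f S \<subseteq> F S" for S
    using funpow_F[of 1 S] \<open>m \<ge> 1\<close> by simp
  have id_F: "S \<subseteq> F S" for S
    using funpow_F[of 0 S] by simp
  have "S \<subseteq> omega F S" for S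
    using UN_upper[of 0 UNIV "\<lambda>n. (F ^^ n) S"] by (simp add: omega_def)
  then have "extensive (omega F)"
    by (simp add: extensive_def le_fun_def)
  moreover have "omega F R \<subseteq> inf g h (omega F R)" if R: "R \<subseteq> inf g h (f R)" for R
  proof -
    define Rs where "Rs n = (F ^^ n) R" for n
    have Rs_0: "Rs 0 = R" and Rs_Suc: "Rs (Suc n) = F (Rs n)" for n
      by (simp_all add: Rs_def)
    have Rs_mono: "Rs n \<subseteq> Rs k" if "n \<le> k" for n k
      using lift_Suc_mono_le[of Rs, OF _ that] id_F by (simp add: Rs_Suc)
    have Rs_omega: "Rs n \<subseteq> omega F R" for n
      by (auto simp: omega_def Rs_def)
    have g_step: "Rs n \<subseteq> g (f (Rs n))" for n
    proof (induction n)
      case 0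
      then show ?case using R by (simp add: Rs_0)
    next
      case (Suc n)
      \<comment> \<open>These sets make up \<open>Rs (Suc n)\<close>, so each can be bounded
        separately by the common target; \<open>f\<close> need not preserve the union.\<close>
      have "(f ^^ i) (Rs n) \<subseteq> g (f (Rs (Suc n)))" if "i \<le> m" for i
      proof -
        have "(f ^^ i) (Rs n) \<subseteq> (f ^^ i) (g (f (Rs n)))"
          using funpow_mono[OF \<open>mono f\<close> Suc] .
        also have "\<dots> \<subseteq> g ((f ^^ i) (f (Rs n)))"
          using \<open>mono f\<close> \<open>compatible f g\<close> by (rule funpow_compatible)
        also have "\<dots> = g (f ((f ^^ i) (Rs n)))"
          by (simp add: funpow_swap1)
        also have "\<dots> \<subseteq> g (f (Rs (Suc n)))"
          using funpow_F[OF that] \<open>mono f\<close> \<open>mono g\<close> by (simp add: Rs_Suc monoD)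
        finally show ?thesis .
      qed
      then show ?case
        unfolding Rs_Suc[of n] by (subst F) (simp add: UN_subset_iff Rs_Suc)
    qed
    \<comment> \<open>This uses the top iterate \<open>f ^^ m\<close>, the largest one that
      \<open>F\<close> contains.\<close>
    have gm_step: "Rs n \<subseteq> (g ^^ m) (Rs (Suc n))" for n
      using subset_funpow_funpow[OF \<open>mono f\<close> \<open>mono g\<close> \<open>compatible f g\<close> g_step, of n m]
        funpow_mono[OF \<open>mono g\<close> funpow_F[of m "Rs n"], of m]
      by (auto simp: Rs_Suc)
    have h_step: "Rs n \<subseteq> h (Rs (m * n + 2))" for n
    proof (induction n)
      case 0
      have "f R \<subseteq> Rs 2"
        using f_F[of R] Rs_mono[of 1 2] Rs_Suc[of 0] Rs_0 by auto
      with \<open>mono h\<close> have "h (f R) \<subseteq> h (Rs 2)" by (rule monoD)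
      then show ?case using R by (auto simp: Rs_0 numeral_2_eq_2)
    next
      case (Suc n)
      \<comment> \<open>Each further \<open>f\<close> costs one use of
        \<open>g ^^ m\<close>,\<open>h\<close>-compatibility and raises the stage inside
        \<open>h\<close> by one.\<close>
      have f_h: "(f ^^ i) (Rs n) \<subseteq> h (Rs (m * n + 2 + i))" if "i \<le> m" for i
        using that
      proof (induction i)
        case 0
        then show ?case using \<open>Rs n \<subseteq> h (Rs (m * n + 2))\<close> by simp
      next
        case (Suc i)
        let ?S = "Rs (m * n + 2 + i)"
        \<comment> \<open>By \<open>gm_step\<close>,
          \<open>(f ^^ i) (Rs n) \<subseteq> Rs (Suc n)\<close> lies in \<open>g ^^ m\<close> of
          stage \<open>n + 2\<close>. The offset 2 and \<open>m \<ge> 1\<close> ensure that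
          \<open>?S\<close> is no earlier than that stage, even for
          \<open>n = i = 0\<close>.\<close>
        have "n \<le> m * n" using \<open>m \<ge> 1\<close> by simp
        then have "Suc (Suc n) \<le> m * n + 2 + i" by linarith
        then have "(g ^^ m) (Rs (Suc (Suc n))) \<subseteq> (g ^^ m) ?S"
          by (intro funpow_mono[OF \<open>mono g\<close>] Rs_mono)
        then have "(f ^^ i) (Rs n) \<subseteq> (g ^^ m) ?S"
          using funpow_F[of i "Rs n"] gm_step[of "Suc n"] Suc.prems by (auto simp: Rs_Suc)
        with Suc have "(f ^^ i) (Rs n) \<subseteq> inf (g ^^ m) h ?S" by simp
        with \<open>mono f\<close> have "f ((f ^^ i) (Rs n)) \<subseteq> f (inf (g ^^ m) h ?S)" by (rule monoD)
        also have "\<dots> \<subseteq> h (f ?S)"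
          using \<open>compatible2 f (g ^^ m) h\<close> by (simp add: compatible2_def le_fun_def)
        also have "\<dots> \<subseteq> h (Rs (Suc (m * n + 2 + i)))"
          unfolding Rs_Suc using \<open>mono h\<close> f_F by (rule monoD)
        finally show ?case by simp
      qed
      \<comment> \<open>The worst case \<open>i = m\<close> reaches index
        \<open>m * n + 2 + m = m * Suc n + 2\<close>, which explains the slope
        \<open>m\<close>.\<close>
      have "(f ^^ i) (Rs n) \<subseteq> h (Rs (m * Suc n + 2))" if "i \<le> m" for i
      proof -
        have "h (Rs (m * n + 2 + i)) \<subseteq> h (Rs (m * Suc n + 2))"
          using that by (intro monoD[OF \<open>mono h\<close>] Rs_mono) simp
        with f_h[OF that] show ?thesis by blast
      qed
      then show ?case unfolding Rs_Suc[of n] F[of "Rs n"] by (simp add: UN_subset_iff)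
    qed
    \<comment> \<open>Each stage bound lands in some later stage, so monotonicity alone lifts it to
      the limit.\<close>
    have "Rs n \<subseteq> g (omega F R)" for n
    proof -
      have "f (Rs n) \<subseteq> omega F R"
        using f_F[of "Rs n"] Rs_omega[of "Suc n"] by (auto simp: Rs_Suc)
      with \<open>mono g\<close> have "g (f (Rs n)) \<subseteq> g (omega F R)" by (rule monoD)
      with g_step show ?thesis by blast
    qed
    moreover have "Rs n \<subseteq> h (omega F R)" for n
      using h_step[of n] monoD[OF \<open>mono h\<close> Rs_omega] by blast
    ultimately have "(\<Union>n. Rs n) \<subseteq> inf g h (omega F R)"
      by (simp add: UN_subset_iff)
    then show ?thesis by (simp add: omega_def Rs_def)
  qed
  ultimately show ?thesis
    unfolding sound_via_def F_def by blast
qed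

end
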